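(* Consider the Geometric Gradient Method with Momentum (GGMM, described in the context) with $a\ge 2$ and $\tau=0$, with stopping condition based on M-stationarity. Assume that $f$ is continuously differentiable. Assume moreover that one of the following holds: (a) the max-rule is used to set $\mu_k$, and $f$ is bounded from below and uniformly continuous on the sublevel set $\mathcal L_0=\{x\in D\mid f(x)\le f(x_0)\}$; (b) the average-rule is used to set $\mu_k$. If, for every $k$, $x_k$ is not an M-stationary point, then any accumulation point $\bar x$ of the sequence $\{x_k\}$ generated by GGMM is an M-stationary point of the problem $\min_{x\in D} f(x)$.
   Context: Let $\mathbb X$ be a Euclidean space (finite-dimensional real inner product space), $f:\mathbb X\to\mathbb R$ differentiable, $D\subset\mathbb X$ nonempty and closed (not necessarily convex). The problem is $\min f(x)$ subject to $x\in D$. The set-valued projection is $P_D(x)=\operatorname{argmin}_{z\in D}\|z-x\|$ (nonempty and compact for every $x$). Normal cones and stationarity. For $x\in D$, a vector $v$ is tangent to $D$ at $x$ if there are sequences $z_k\in D$, $t_k>0$ with $z_k\to x$, $t_k\to 0$, $(z_k-x)/t_k\to v$; $T_D(x)$ is the set of tangent vectors. The regular normal cone is $\widehat{\mathcal N}_D(x)=\{v\in\mathbb X\mid \langle v,w\rangle\le 0\ \forall w\in T_D(x)\}$. The general (Mordukhovich) normal cone $\mathcal N_D(x)$ is the set of all $v$ for which there are sequences $z_k\in D$, $v_k\in\widehat{\mathcal N}_D(z_k)$ with $z_k\to x$, $v_k\to v$. A point $x\in D$ is M-stationary if $-\nabla f(x)\in\mathcal N_D(x)$. GGMM. Inputs: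 $x_0\in D$, $0\le\tau<\alpha_{\min}\le\alpha_{\max}<\infty$, $\beta_{\max}\ge0$, $c\in(0,1)$, $\delta\in(0,1)$, $a\ge1$. Set $x_{-1}=x_0$. For $k=0,1,2,\dots$, as long as $x_k$ does not satisfy the stopping condition (being a stationary point of the chosen type): choose any $\alpha_{k0}\in[\alpha_{\min},\alpha_{\max}]$ and $\beta_{k0}\in[0,\beta_{\max}]$; set a reference value $\mu_k\ge f(x_k)$; for $j=0,1,2,\dots$ let $\alpha_{kj}=\delta^j\alpha_{k0}$, $\beta_{kj}=\beta_{k0}$ if $j=0$ and $\beta_{kj}=\beta_{k0}\left(\frac{\max\{\alpha_{kj}-\tau,0\}}{\alpha_{k0}-\tau}\right)^a$ if $j\ge1$, and choose any $y_{kj}\in P_D(x_k-\alpha_{kj}\nabla f(x_k)+\beta_{kj}(x_k-x_{k-1}))$; the inner loop (backtracking) stops at the first $j$ such that $f(y_{kj})\le\mu_k-\frac{c}{2\alpha_{kj}}\|y_{kj}-x_k\|^2$. With this $j$, set $\alpha_k=\alpha_{kj}$, $\beta_k=\beta_{kj}$, $x_{k+1}=y_{kj}$. Rules for $\mu_k$. Max-rule, for some fixed $M\in\mathbb N$: $\mu_k=\max_{i\in\{\max\{0,k-M\},\dots,k\}}f(x_i)$. Average-rule, for some fixed $p\in(0,1]$: $\mu_k=(1-p)\mu_{k-1}+p f(x_k)$, with initial value $\mu_{-1}\ge f(x_0)$ (e.g. $\mu_{-1}=f(x_0)$). *)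

theory Defs
  imports "HOL-Analysis.Analysis"
begin

definition proj_set :: "'a::euclidean_space set \<Rightarrow> 'a \<Rightarrow> 'a set" where
  "proj_set D x = {z. is_arg_min (\<lambda>z. norm (z - x)) (\<lambda>z. z \<in> D) z}"

definition tangent_cone :: "'a::euclidean_space set \<Rightarrow> 'a \<Rightarrow> 'a set" where
  "tangent_cone D x =
     {v. \<exists>(z :: nat \<Rightarrow> 'a) (t :: nat \<Rightarrow> real).
           (\<forall>k. z k \<in> D) \<and> (\<forall>k. t k > 0) \<and> z \<longlonglongrightarrow> x \<and> t \<longlonglongrightarrow> 0 \<and>
           (\<lambda>k. (z k - x) /\<^sub>R t k) \<longlonglongrightarrow> v}"

definition regular_normal_cone :: "'a::euclidean_space set \<Rightarrow> 'a \<Rightarrow> 'a set" where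
  "regular_normal_cone D x = {v. \<forall>w \<in> tangent_cone D x. v \<bullet> w \<le> 0}"

text \<open>The general (Mordukhovich) normal cone.\<close>

definition normal_cone :: "'a::euclidean_space set \<Rightarrow> 'a \<Rightarrow> 'a set" where
  "normal_cone D x =
     {v. \<exists>z u :: nat \<Rightarrow> 'a.
           (\<forall>k. z k \<in> D \<and> u k \<in> regular_normal_cone D (z k)) \<and> z \<longlonglongrightarrow> x \<and> u \<longlonglongrightarrow> v}"

text \<open>In all that follows \<open>grad\<close> stands for the gradient map of the objective function.\<close>

definition M_stationary :: "('a::euclidean_space \<Rightarrow> 'a) \<Rightarrow> 'a set \<Rightarrow> 'a \<Rightarrow> bool" where
  "M_stationary grad D x \<longleftrightarrow> x \<in> D \<and> - grad x \<in> normal_cone D x"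

definition trial_alpha :: "real \<Rightarrow> real \<Rightarrow> nat \<Rightarrow> real" where
  "trial_alpha \<delta> \<alpha>0 j = \<delta> ^ j * \<alpha>0"

definition trial_beta :: "real \<Rightarrow> real \<Rightarrow> real \<Rightarrow> real \<Rightarrow> real \<Rightarrow> nat \<Rightarrow> real" where
  "trial_beta \<tau> \<delta> a \<alpha>0 \<beta>0 j =
     (if j = 0 then \<beta>0
      else \<beta>0 * (max (trial_alpha \<delta> \<alpha>0 j - \<tau>) 0 / (\<alpha>0 - \<tau>)) powr a)"

definition sufficient_decrease ::
  "('a::euclidean_space \<Rightarrow> real) \<Rightarrow> real \<Rightarrow> real \<Rightarrow> real \<Rightarrow> 'a \<Rightarrow> 'a \<Rightarrow> bool" where
  "sufficient_decrease f c \<alpha> \<mu> x y \<longleftrightarrow> f y \<le> \<mu> - c / (2 * \<alpha>) * (norm (y - x))\<^sup>2"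

text \<open>One outer iteration, from the current point \<open>x\<close> with predecessor \<open>xprev\<close> and reference value
  \<open>\<mu>\<close> to the new point \<open>xnext\<close>. Backtracking ends at the first accepted index \<open>j\<close>;
  only the trial points \<open>y 0, \<dots>, y j\<close> are relevant, and each may be any element of the projection.\<close>

definition ggmm_step ::
  "('a::euclidean_space \<Rightarrow> real) \<Rightarrow> ('a \<Rightarrow> 'a) \<Rightarrow> 'a set \<Rightarrow>
   real \<Rightarrow> real \<Rightarrow> real \<Rightarrow> real \<Rightarrow> real \<Rightarrow> real \<Rightarrow> real \<Rightarrow> 'a \<Rightarrow> 'a \<Rightarrow> real \<Rightarrow> 'a \<Rightarrow> bool" where
  "ggmm_step f grad D \<tau> \<alpha>min \<alpha>max \<beta>max c \<delta> a xprev x \<mu> xnext \<longleftrightarrow>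
     (\<exists>\<alpha>0 \<beta>0 (y :: nat \<Rightarrow> 'a) j.
        \<alpha>0 \<in> {\<alpha>min..\<alpha>max} \<and> \<beta>0 \<in> {0..\<beta>max} \<and> f x \<le> \<mu> \<and>
        (\<forall>i\<le>j. y i \<in> proj_set D (x - trial_alpha \<delta> \<alpha>0 i *\<^sub>R grad x
                                      + trial_beta \<tau> \<delta> a \<alpha>0 \<beta>0 i *\<^sub>R (x - xprev))) \<and>
        (\<forall>i<j. \<not> sufficient_decrease f c (trial_alpha \<delta> \<alpha>0 i) \<mu> x (y i)) \<and>
        sufficient_decrease f c (trial_alpha \<delta> \<alpha>0 j) \<mu> x (y j) \<and>
        xnext = y j)"

text \<open>\<open>x\<close> is a sequence of iterates and \<open>\<mu>\<close> the sequence of reference values of the method with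
  stopping condition \<open>stop\<close>; the entries of \<open>x\<close> after the first stopping index are irrelevant.
  The case distinction encodes the convention $x_{-1} = x_0$.\<close>

definition ggmm_sequence ::
  "('a::euclidean_space \<Rightarrow> bool) \<Rightarrow> ('a \<Rightarrow> real) \<Rightarrow> ('a \<Rightarrow> 'a) \<Rightarrow> 'a set \<Rightarrow>
   real \<Rightarrow> real \<Rightarrow> real \<Rightarrow> real \<Rightarrow> real \<Rightarrow> real \<Rightarrow> real \<Rightarrow> (nat \<Rightarrow> 'a) \<Rightarrow> (nat \<Rightarrow> real) \<Rightarrow> bool" where
  "ggmm_sequence stop f grad D \<tau> \<alpha>min \<alpha>max \<beta>max c \<delta> a x \<mu> \<longleftrightarrow>
     x 0 \<in> D \<and>
     (\<forall>k. (\<forall>i\<le>k. \<not> stop (x i)) \<longrightarrow>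
        ggmm_step f grad D \<tau> \<alpha>min \<alpha>max \<beta>max c \<delta> a
          (if k = 0 then x 0 else x (k - 1)) (x k) (\<mu> k) (x (Suc k)))"

text \<open>Truncated subtraction makes \<open>k - M\<close> equal to $\max\{0, k - M\}$.\<close>

definition max_rule ::
  "('a::euclidean_space \<Rightarrow> real) \<Rightarrow> nat \<Rightarrow> (nat \<Rightarrow> 'a) \<Rightarrow> (nat \<Rightarrow> real) \<Rightarrow> bool" where
  "max_rule f M x \<mu> \<longleftrightarrow> (\<forall>k. \<mu> k = Max ((\<lambda>i. f (x i)) ` {k - M..k}))"

text \<open>The existentially quantified \<open>\<mu>init\<close> is the initial value $\mu_{-1}$.\<close>

definition average_rule ::
  "('a::euclidean_space \<Rightarrow> real) \<Rightarrow> real \<Rightarrow> (nat \<Rightarrow> 'a) \<Rightarrow> (nat \<Rightarrow> real) \<Rightarrow> bool" where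
  "average_rule f p x \<mu> \<longleftrightarrow>
     (\<exists>\<mu>init \<ge> f (x 0). \<mu> 0 = (1 - p) * \<mu>init + p * f (x 0)) \<and>
     (\<forall>k. \<mu> (Suc k) = (1 - p) * \<mu> k + p * f (x (Suc k)))"

definition accumulation_point :: "(nat \<Rightarrow> 'a::topological_space) \<Rightarrow> 'a \<Rightarrow> bool" where
  "accumulation_point x xbar \<longleftrightarrow> (\<exists>r. strict_mono r \<and> (x \<circ> r) \<longlonglongrightarrow> xbar)"

end

theory Submission
  imports Defs
begin

text \<open>
  The momentum term can be absorbed into the gradient. For \<open>\<tau> = 0\<close> every trial
  satisfies \<open>\<beta> \<le> (\<beta>max / \<alpha>min) * \<alpha>\<close>, so with \<open>d = x\<^sub>k - x\<^sub>k\<^sub>-\<^sub>1\<close> and \<open>e = (\<beta> / \<alpha>) d\<close> a trial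
  point is a projection of \<open>x\<^sub>k - \<alpha> (grad x\<^sub>k - e)\<close>, where \<open>norm e\<close> is at most a fixed multiple of
  \<open>norm d\<close>. The method is thus a projected gradient method whose gradient errors \<open>e\<close> vanish as
  soon as the steps do.

  The steps vanish because, up to a constant, \<open>\<mu>\<^sub>k - f x\<^sub>k\<^sub>+\<^sub>1\<close> bounds the squared step
  length, and this gap tends to \<open>0\<close> under either rule. For the average rule it is a multiple of
  \<open>\<mu>\<^sub>k - \<mu>\<^sub>k\<^sub>+\<^sub>1\<close>; for the max rule it follows from the argument of Grippo, Lampariello and
  Lucidi, which uses the uniform continuity of \<open>f\<close> to transport the limit of the reference values
  back through the window of the last iterates.

  A projection \<open>u\<close> of \<open>z - \<alpha> g\<close> onto \<open>D\<close> makes \<open>(z - u) / \<alpha> - g\<close> a regular normal at \<open>u\<close>.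
  Hence an accumulation point is M-stationary once there are such projections \<open>u\<close>, with \<open>z = x\<^sub>k\<close>
  and \<open>g = grad x\<^sub>k - e\<close>, that converge to it and whose residuals \<open>(z - u) / \<alpha>\<close> tend to \<open>0\<close>
  (lemma \<open>normal_cone_proj_step_limit\<close>). Pass to a subsequence along which the accepted step sizes
  \<open>\<alpha>\<close> converge. If their limit is positive, the accepted points \<open>x\<^sub>k\<^sub>+\<^sub>1\<close> serve as \<open>u\<close>, because
  the steps vanish. If it is \<open>0\<close>, eventually some trial was rejected, and the last rejected trial
  points, with step size \<open>\<alpha> / \<delta>\<close>, serve as \<open>u\<close>: playing the failure of the decrease test
  against the minimality of the projection forces the residual to be small (lemma
  \<open>rejected_trial_residual\<close>).
\<close>

section \<open>Projections and normal cones\<close>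

lemma proj_setD:
  assumes "y \<in> proj_set D p"
  shows "y \<in> D" and "\<And>z. z \<in> D \<Longrightarrow> norm (y - p) \<le> norm (z - p)"
  using assms unfolding proj_set_def is_arg_min_def by (auto simp: not_less)

lemma regular_normal_cone_scaleR:
  assumes "v \<in> regular_normal_cone D x" and "0 \<le> s"
  shows "s *\<^sub>R v \<in> regular_normal_cone D x"
  using assms unfolding regular_normal_cone_def
  by (auto simp: mult_nonneg_nonpos)

text \<open>Minimality of \<open>y\<close> gives \<open>2 (p - y) \<bullet> (z - y) \<le> (norm (z - y))\<^sup>2\<close> for every \<open>z \<in> D\<close>. The right-hand
  side is of second order along a tangent sequence, so it disappears after division by \<open>t k\<close>.\<close>

lemma proj_set_imp_regular_normal:
  assumes y: "y \<in> proj_set D p"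
  shows "p - y \<in> regular_normal_cone D y"
  unfolding regular_normal_cone_def
proof (intro CollectI ballI)
  fix w assume "w \<in> tangent_cone D y"
  then obtain z and t :: "nat \<Rightarrow> real" where
    zD: "\<And>k. z k \<in> D" and t: "\<And>k. 0 < t k" and zlim: "z \<longlonglongrightarrow> y"
    and wlim: "(\<lambda>k. (z k - y) /\<^sub>R t k) \<longlonglongrightarrow> w"
    unfolding tangent_cone_def by auto
  have ineq: "2 * ((p - y) \<bullet> ((z k - y) /\<^sub>R t k)) \<le> ((z k - y) /\<^sub>R t k) \<bullet> (z k - y)" for k
  proof -
    have "norm (y - p) \<le> norm (z k - p)"
      using proj_setD(2)[OF y zD] .
    then have "(y - p) \<bullet> (y - p) \<le> (z k - p) \<bullet> (z k - p)"
      by (simp add: norm_le)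
    then have "2 * ((p - y) \<bullet> (z k - y)) \<le> (z k - y) \<bullet> (z k - y)"
      by (simp add: inner_diff_left inner_diff_right inner_commute algebra_simps)
    then have "inverse (t k) * (2 * ((p - y) \<bullet> (z k - y)))
        \<le> inverse (t k) * ((z k - y) \<bullet> (z k - y))"
      using t[of k] by (intro mult_left_mono) auto
    then show ?thesis by (simp add: algebra_simps)
  qed
  have "(\<lambda>k. 2 * ((p - y) \<bullet> ((z k - y) /\<^sub>R t k))) \<longlonglongrightarrow> 2 * ((p - y) \<bullet> w)"
    by (intro tendsto_intros wlim)
  moreover have "(\<lambda>k. ((z k - y) /\<^sub>R t k) \<bullet> (z k - y)) \<longlonglongrightarrow> w \<bullet> (y - y)"
    by (intro tendsto_intros wlim zlim)
  ultimately have "2 * ((p - y) \<bullet> w) \<le> w \<bullet> (y - y)"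
    by (rule LIMSEQ_le) (use ineq in auto)
  then show "(p - y) \<bullet> w \<le> 0" by simp
qed

text \<open>Compare the distances of \<open>y\<close> and of the competitor \<open>x\<close> to the projected point, and expand
  the squares.\<close>

lemma proj_step_inner_le:
  assumes x: "x \<in> D" and y: "y \<in> proj_set D (x - \<alpha> *\<^sub>R g)"
  shows "(norm (y - x))\<^sup>2 + 2 * \<alpha> * (g \<bullet> (y - x)) \<le> 0"
proof -
  have "norm (y - (x - \<alpha> *\<^sub>R g)) \<le> norm (x - (x - \<alpha> *\<^sub>R g))"
    using proj_setD(2)[OF y x] .
  then have "norm ((y - x) + \<alpha> *\<^sub>R g) \<le> norm (\<alpha> *\<^sub>R g)"
    by (simp add: algebra_simps)
  then have "((y - x) + \<alpha> *\<^sub>R g) \<bullet> ((y - x) + \<alpha> *\<^sub>R g) \<le> (\<alpha> *\<^sub>R g) \<bullet> (\<alpha> *\<^sub>R g)"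
    by (simp only: norm_le)
  then show ?thesis
    by (simp add: power2_norm_eq_inner inner_add_left inner_add_right inner_commute)
qed

lemma proj_step_norm_le:
  assumes x: "x \<in> D" and y: "y \<in> proj_set D (x - \<alpha> *\<^sub>R g)" and "0 < \<alpha>"
  shows "norm (y - x) \<le> 2 * \<alpha> * norm g"
proof (cases "y = x")
  case False
  have "(norm (y - x))\<^sup>2 \<le> 2 * \<alpha> * (- (g \<bullet> (y - x)))"
    using proj_step_inner_le[OF x y] by simp
  also have "\<dots> \<le> 2 * \<alpha> * (norm g * norm (y - x))"
    using norm_cauchy_schwarz[of "-g" "y - x"] \<open>0 < \<alpha>\<close> by (intro mult_left_mono) auto
  finally have "norm (y - x) * norm (y - x) \<le> (2 * \<alpha> * norm g) * norm (y - x)"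
    by (simp add: power2_eq_square algebra_simps)
  then show ?thesis using False by simp
qed (use assms in simp)

text \<open>The passage to the limit that yields stationarity. Since \<open>(z l - u l) / \<alpha> l - g l\<close> is a regular
  normal at \<open>u l\<close>, only the residual \<open>(z l - u l) / \<alpha> l\<close> has to be controlled, and \<open>\<alpha> l\<close>
  itself may tend to \<open>0\<close>.\<close>

lemma normal_cone_proj_step_limit:
  assumes step: "\<forall>\<^sub>F l in sequentially. 0 < \<alpha> l \<and> u l \<in> proj_set D (z l - \<alpha> l *\<^sub>R g l)"
    and u: "u \<longlonglongrightarrow> x" and small: "(\<lambda>l. (z l - u l) /\<^sub>R \<alpha> l) \<longlonglongrightarrow> 0" and g: "g \<longlonglongrightarrow> g0"
  shows "- g0 \<in> normal_cone D x"
proof -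
  define n where "n l = (z l - u l) /\<^sub>R \<alpha> l - g l" for l
  obtain N where N: "\<And>l. N \<le> l \<Longrightarrow> 0 < \<alpha> l \<and> u l \<in> proj_set D (z l - \<alpha> l *\<^sub>R g l)"
    using step unfolding eventually_sequentially by auto
  have "u l \<in> D \<and> n l \<in> regular_normal_cone D (u l)" if "N \<le> l" for l
  proof -
    have "inverse (\<alpha> l) *\<^sub>R ((z l - \<alpha> l *\<^sub>R g l) - u l) \<in> regular_normal_cone D (u l)"
      using N[OF that] by (intro regular_normal_cone_scaleR proj_set_imp_regular_normal) auto
    also have "inverse (\<alpha> l) *\<^sub>R ((z l - \<alpha> l *\<^sub>R g l) - u l) = n l"
      using N[OF that] by (simp add: n_def algebra_simps)
    finally show ?thesis using N[OF that] proj_setD(1) by blast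
  qed
  then have "\<forall>l. u (l + N) \<in> D \<and> n (l + N) \<in> regular_normal_cone D (u (l + N))" by simp
  moreover have "n \<longlonglongrightarrow> 0 - g0"
    unfolding n_def by (intro tendsto_intros small g)
  then have "(\<lambda>l. n (l + N)) \<longlonglongrightarrow> - g0"
    using LIMSEQ_ignore_initial_segment by force
  moreover have "(\<lambda>l. u (l + N)) \<longlonglongrightarrow> x"
    using u by (rule LIMSEQ_ignore_initial_segment)
  ultimately show ?thesis
    unfolding normal_cone_def
    by (intro CollectI exI[of _ "\<lambda>l. u (l + N)"] exI[of _ "\<lambda>l. n (l + N)"] conjI)
qed

section \<open>A single iteration\<close>

text \<open>The damping factor of the momentum parameter is \<open>(\<delta> ^ j) powr a\<close>, which decays at least as
  fast as the step size; for \<open>j = 0\<close> the factor \<open>\<alpha>0 / \<alpha>min \<ge> 1\<close> does the job.\<close>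

lemma trial_beta_bounds:
  assumes "0 < \<delta>" "\<delta> < 1" "1 \<le> a" "0 < \<alpha>min" "\<alpha>min \<le> \<alpha>0" "0 \<le> \<beta>0" "\<beta>0 \<le> \<beta>max"
  shows "0 \<le> trial_beta 0 \<delta> a \<alpha>0 \<beta>0 j"
    and "trial_beta 0 \<delta> a \<alpha>0 \<beta>0 j \<le> \<beta>max / \<alpha>min * trial_alpha \<delta> \<alpha>0 j"
proof -
  have beta: "trial_beta 0 \<delta> a \<alpha>0 \<beta>0 j = (if j = 0 then \<beta>0 else \<beta>0 * (\<delta> ^ j) powr a)"
    using assms by (simp add: trial_beta_def trial_alpha_def)
  show "0 \<le> trial_beta 0 \<delta> a \<alpha>0 \<beta>0 j"
    unfolding beta using assms by simp
  have "(\<delta> ^ j) powr a \<le> (\<delta> ^ j) powr 1"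
    using assms by (intro powr_mono') (auto intro: power_le_one)
  then have "(\<delta> ^ j) powr a \<le> \<delta> ^ j"
    using assms by simp
  then have "trial_beta 0 \<delta> a \<alpha>0 \<beta>0 j \<le> \<beta>0 * \<delta> ^ j"
    unfolding beta using assms by (auto intro: mult_left_mono)
  also have "\<dots> \<le> \<beta>max * (\<alpha>0 / \<alpha>min) * \<delta> ^ j"
  proof (intro mult_right_mono)
    have "\<beta>0 * 1 \<le> \<beta>max * (\<alpha>0 / \<alpha>min)"
      using assms by (intro mult_mono) auto
    then show "\<beta>0 \<le> \<beta>max * (\<alpha>0 / \<alpha>min)" by simp
  qed (use assms in simp)
  finally show "trial_beta 0 \<delta> a \<alpha>0 \<beta>0 j \<le> \<beta>max / \<alpha>min * trial_alpha \<delta> \<alpha>0 j"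
    by (simp add: trial_alpha_def mult_ac)
qed

lemma trial_as_perturbed_gradient_step:
  assumes "0 < \<delta>" "\<delta> < 1" "1 \<le> a" "0 < \<alpha>min" "\<alpha>min \<le> \<alpha>0" "0 \<le> \<beta>0" "\<beta>0 \<le> \<beta>max"
    and y: "y \<in> proj_set D (x - trial_alpha \<delta> \<alpha>0 i *\<^sub>R g + trial_beta 0 \<delta> a \<alpha>0 \<beta>0 i *\<^sub>R d)"
  obtains e where "norm e \<le> \<beta>max / \<alpha>min * norm d"
    and "y \<in> proj_set D (x - trial_alpha \<delta> \<alpha>0 i *\<^sub>R (g - e))"
proof
  let ?\<alpha> = "trial_alpha \<delta> \<alpha>0 i" and ?\<beta> = "trial_beta 0 \<delta> a \<alpha>0 \<beta>0 i"
  have pos: "0 < ?\<alpha>"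
    using assms by (simp add: trial_alpha_def)
  have b: "0 \<le> ?\<beta>" "?\<beta> \<le> \<beta>max / \<alpha>min * ?\<alpha>"
    using trial_beta_bounds[OF assms(1-7)] by auto
  have "?\<beta> / ?\<alpha> \<le> \<beta>max / \<alpha>min"
    using b(2) pos by (simp add: pos_divide_le_eq)
  then show "norm ((?\<beta> / ?\<alpha>) *\<^sub>R d) \<le> \<beta>max / \<alpha>min * norm d"
    using b(1) pos mult_right_mono[of "?\<beta> / ?\<alpha>" "\<beta>max / \<alpha>min" "norm d"] by simp
  have "?\<alpha> *\<^sub>R (g - (?\<beta> / ?\<alpha>) *\<^sub>R d) = ?\<alpha> *\<^sub>R g - ?\<beta> *\<^sub>R d"
    using pos by (simp add: scaleR_diff_right)
  then show "y \<in> proj_set D (x - ?\<alpha> *\<^sub>R (g - (?\<beta> / ?\<alpha>) *\<^sub>R d))"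
    using y by (simp only: diff_diff_eq2 diff_add_eq)
qed

text \<open>What the convergence proof needs to know about one iteration. An accepted step size below
  \<open>\<alpha>min\<close> cannot be the initial one, so it comes with a rejected trial whose step size is larger
  by exactly one factor \<open>1 / \<delta>\<close>.\<close>

lemma ggmm_step_as_perturbed_gradient_step:
  assumes step: "ggmm_step f grad D 0 \<alpha>min \<alpha>max \<beta>max c \<delta> a xprev x \<mu> xnext"
    and par: "0 < \<delta>" "\<delta> < 1" "1 \<le> a" "0 < \<alpha>min"
  obtains \<alpha> e where "0 < \<alpha>" "\<alpha> \<le> \<alpha>max" "norm e \<le> \<beta>max / \<alpha>min * norm (x - xprev)"
    "xnext \<in> proj_set D (x - \<alpha> *\<^sub>R (grad x - e))"
    "sufficient_decrease f c \<alpha> \<mu> x xnext"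
    "\<alpha> < \<alpha>min \<Longrightarrow> \<exists>e' y. norm e' \<le> \<beta>max / \<alpha>min * norm (x - xprev) \<and>
       y \<in> proj_set D (x - (\<alpha> / \<delta>) *\<^sub>R (grad x - e')) \<and>
       \<not> sufficient_decrease f c (\<alpha> / \<delta>) \<mu> x y"
proof -
  obtain \<alpha>0 \<beta>0 y j where
    \<alpha>0: "\<alpha>min \<le> \<alpha>0" "\<alpha>0 \<le> \<alpha>max" and \<beta>0: "0 \<le> \<beta>0" "\<beta>0 \<le> \<beta>max"
    and y: "\<And>i. i \<le> j \<Longrightarrow> y i \<in> proj_set D (x - trial_alpha \<delta> \<alpha>0 i *\<^sub>R grad x
                              + trial_beta 0 \<delta> a \<alpha>0 \<beta>0 i *\<^sub>R (x - xprev))"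
    and rej: "\<And>i. i < j \<Longrightarrow> \<not> sufficient_decrease f c (trial_alpha \<delta> \<alpha>0 i) \<mu> x (y i)"
    and acc: "sufficient_decrease f c (trial_alpha \<delta> \<alpha>0 j) \<mu> x (y j)"
    and xnext: "xnext = y j"
    using step unfolding ggmm_step_def by auto
  note perturbed = trial_as_perturbed_gradient_step[OF par \<alpha>0(1) \<beta>0 y]
  obtain e where e: "norm e \<le> \<beta>max / \<alpha>min * norm (x - xprev)"
    "y j \<in> proj_set D (x - trial_alpha \<delta> \<alpha>0 j *\<^sub>R (grad x - e))"
    using perturbed[of j] by blast
  show thesis
  proof (rule that)
    show "0 < trial_alpha \<delta> \<alpha>0 j"
      using par \<alpha>0 by (simp add: trial_alpha_def)
    have "\<delta> ^ j * \<alpha>0 \<le> 1 * \<alpha>0"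
      using par \<alpha>0 by (intro mult_right_mono) (auto intro: power_le_one)
    then show "trial_alpha \<delta> \<alpha>0 j \<le> \<alpha>max"
      using \<alpha>0 by (simp add: trial_alpha_def)
    show "norm e \<le> \<beta>max / \<alpha>min * norm (x - xprev)"
      "xnext \<in> proj_set D (x - trial_alpha \<delta> \<alpha>0 j *\<^sub>R (grad x - e))"
      "sufficient_decrease f c (trial_alpha \<delta> \<alpha>0 j) \<mu> x xnext"
      using e acc xnext by simp_all
    assume small: "trial_alpha \<delta> \<alpha>0 j < \<alpha>min"
    then have "j \<noteq> 0"
      using \<alpha>0 by (auto simp: trial_alpha_def intro: ccontr)
    then obtain i where i: "j = Suc i"
      by (cases j) auto
    have \<alpha>i: "trial_alpha \<delta> \<alpha>0 i = trial_alpha \<delta> \<alpha>0 j / \<delta>"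
      using par by (simp add: trial_alpha_def i)
    show "\<exists>e' y. norm e' \<le> \<beta>max / \<alpha>min * norm (x - xprev) \<and>
       y \<in> proj_set D (x - (trial_alpha \<delta> \<alpha>0 j / \<delta>) *\<^sub>R (grad x - e')) \<and>
       \<not> sufficient_decrease f c (trial_alpha \<delta> \<alpha>0 j / \<delta>) \<mu> x y"
      using perturbed[of i] rej[of i] unfolding \<alpha>i i by (metis le_SucI le_refl lessI)
  qed
qed

lemma gderiv_mean_value:
  assumes "\<And>z. GDERIV f z :> grad z"
  obtains \<xi> where "\<xi> \<in> closed_segment x y" and "f y - f x = grad \<xi> \<bullet> (y - x)"
proof -
  define \<phi> where "\<phi> t = x + t *\<^sub>R (y - x)" for t :: real
  have "((\<lambda>t. f (\<phi> t)) has_derivative (\<lambda>h. (h *\<^sub>R (y - x)) \<bullet> grad (\<phi> t)))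
      (at t within {0..1})" for t
  proof (rule has_derivative_compose[where g = f])
    show "(\<phi> has_derivative (\<lambda>h. h *\<^sub>R (y - x))) (at t within {0..1})"
      unfolding \<phi>_def by (auto intro!: derivative_eq_intros)
    show "(f has_derivative (\<lambda>h. h \<bullet> grad (\<phi> t))) (at (\<phi> t))"
      using assms unfolding gderiv_def .
  qed
  then obtain t where t: "t \<in> {0<..<1}"
    and "f (\<phi> 1) - f (\<phi> 0) = ((1 - 0) *\<^sub>R (y - x)) \<bullet> grad (\<phi> t)"
    using mvt_simple[of 0 "1::real" "\<lambda>t. f (\<phi> t)" "\<lambda>t h. (h *\<^sub>R (y - x)) \<bullet> grad (\<phi> t)"]
    by auto
  then have "f y - f x = grad (\<phi> t) \<bullet> (y - x)"
    by (simp add: \<phi>_def inner_commute)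
  moreover have "\<phi> t \<in> closed_segment x y"
    unfolding in_segment \<phi>_def using t by (intro exI[of _ t]) (auto simp: algebra_simps)
  ultimately show thesis using that by blast
qed

text \<open>With \<open>s = y - x\<close>, rejection and the mean value theorem give
  \<open>- grad \<xi> \<bullet> s < c / (2 \<alpha>) * (norm s)\<^sup>2\<close>, whereas the projection gives
  \<open>(norm s)\<^sup>2 / (2 \<alpha>) \<le> (e - grad x) \<bullet> s\<close>. In the sum of the two, the quadratic term
  \<open>(1 - c) / (2 \<alpha>) * (norm s)\<^sup>2\<close> survives because \<open>c < 1\<close>, and the gradients enter only through
  their difference. Dividing by \<open>norm s\<close> bounds the residual.\<close>

lemma rejected_trial_residual:
  assumes grad: "\<And>z. GDERIV f z :> grad z"
    and x: "x \<in> D" and y: "y \<in> proj_set D (x - \<alpha> *\<^sub>R (grad x - e))"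
    and rej: "\<not> sufficient_decrease f c \<alpha> \<mu> x y" and \<mu>: "f x \<le> \<mu>"
    and "0 < \<alpha>" "c < 1"
  obtains \<xi> where "\<xi> \<in> closed_segment x y"
    and "norm ((x - y) /\<^sub>R \<alpha>) \<le> 2 / (1 - c) * (norm e + norm (grad \<xi> - grad x))"
proof -
  obtain \<xi> where \<xi>: "\<xi> \<in> closed_segment x y" and mv: "f y - f x = grad \<xi> \<bullet> (y - x)"
    using gderiv_mean_value[OF grad] .
  define s where "s = y - x"
  have lower: "- (c / (2 * \<alpha>) * (norm s)\<^sup>2) < grad \<xi> \<bullet> s"
    using rej \<mu> mv unfolding sufficient_decrease_def s_def by simp
  have "(norm s)\<^sup>2 + 2 * \<alpha> * ((grad x - e) \<bullet> s) \<le> 0"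
    using proj_step_inner_le[OF x y] unfolding s_def .
  then have "(norm s)\<^sup>2 / (2 * \<alpha>) + (grad x - e) \<bullet> s \<le> 0"
    using \<open>0 < \<alpha>\<close> by (simp add: field_simps)
  then have "(1 - c) / (2 * \<alpha>) * (norm s)\<^sup>2 \<le> e \<bullet> s + (grad \<xi> - grad x) \<bullet> s"
    using lower by (simp add: inner_diff_left diff_divide_distrib left_diff_distrib)
  also have "\<dots> \<le> norm e * norm s + norm (grad \<xi> - grad x) * norm s"
    by (intro add_mono norm_cauchy_schwarz)
  finally have main: "((1 - c) / 2 * (norm s / \<alpha>)) * norm s
      \<le> (norm e + norm (grad \<xi> - grad x)) * norm s"
    by (simp add: power2_eq_square algebra_simps)
  have "(1 - c) / 2 * (norm s / \<alpha>) \<le> norm e + norm (grad \<xi> - grad x)"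
  proof (cases "s = 0")
    case False
    then show ?thesis using mult_right_le_imp_le[OF main] by simp
  qed simp
  then have "norm s / \<alpha> \<le> 2 / (1 - c) * (norm e + norm (grad \<xi> - grad x))"
    using \<open>c < 1\<close> by (subst (asm) mult.commute) (simp add: pos_le_divide_eq mult_ac)
  moreover have "norm ((x - y) /\<^sub>R \<alpha>) = norm s / \<alpha>"
    using \<open>0 < \<alpha>\<close> by (simp add: s_def norm_minus_commute divide_inverse)
  ultimately show thesis using \<xi> that by simp
qed

section \<open>Vanishing decrease\<close>

lemma sufficient_decrease_imp_le:
  assumes "sufficient_decrease f c \<alpha> \<mu> x y" "0 < \<alpha>" "0 < c"
  shows "f y \<le> \<mu>"
proof -
  have "0 \<le> c / (2 * \<alpha>) * (norm (y - x))\<^sup>2" using assms by simp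
  then show ?thesis using assms(1) unfolding sufficient_decrease_def by linarith
qed

lemma sufficient_decrease_step_bound:
  assumes "sufficient_decrease f c \<alpha> \<mu> x y" "0 < \<alpha>" "\<alpha> \<le> \<alpha>max" "0 < c"
  shows "(norm (y - x))\<^sup>2 \<le> 2 * \<alpha>max / c * (\<mu> - f y)"
proof -
  have "(norm (y - x))\<^sup>2 \<le> 2 * \<alpha> / c * (\<mu> - f y)"
    using assms unfolding sufficient_decrease_def by (simp add: field_simps)
  also have "\<dots> \<le> 2 * \<alpha>max / c * (\<mu> - f y)"
    using assms sufficient_decrease_imp_le[OF assms(1,2,4)]
    by (intro mult_right_mono divide_right_mono) auto
  finally show ?thesis .
qed

lemma tendsto_zero_if_norm_sq_bounded:
  assumes "\<And>k. (norm (s k))\<^sup>2 \<le> C * b k" and "b \<longlonglongrightarrow> (0::real)"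
  shows "s \<longlonglongrightarrow> 0"
proof -
  have "(\<lambda>k. C * b k) \<longlonglongrightarrow> C * 0"
    by (intro tendsto_intros assms)
  then have "(\<lambda>k. C * b k) \<longlonglongrightarrow> 0" by simp
  then have "(\<lambda>k. (norm (s k))\<^sup>2) \<longlonglongrightarrow> 0"
    by (rule Lim_null_comparison[rotated]) (use assms in simp)
  then have "(\<lambda>k. sqrt ((norm (s k))\<^sup>2)) \<longlonglongrightarrow> sqrt 0"
    by (intro tendsto_intros)
  then show ?thesis by (simp add: tendsto_norm_zero_iff)
qed

text \<open>The rule reads \<open>\<mu> k - \<mu> (Suc k) = p * (\<mu> k - f (x (Suc k)))\<close>, so the gap vanishes once \<open>\<mu>\<close>
  converges. As \<open>\<mu>\<close> is nonincreasing and dominates \<open>f\<close> along the iterates, a single convergent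
  subsequence of function values bounds it from below.\<close>

lemma average_rule_vanishing_decrease:
  assumes rule: "average_rule f p x \<mu>" and p: "0 < p"
    and ref: "\<And>k. f (x k) \<le> \<mu> k" and desc: "\<And>k. f (x (Suc k)) \<le> \<mu> k"
    and r: "strict_mono r" and lim: "(\<lambda>l. f (x (r l))) \<longlonglongrightarrow> L"
  shows "(\<lambda>k. \<mu> k - f (x (Suc k))) \<longlonglongrightarrow> 0"
proof -
  have diff: "\<mu> k - \<mu> (Suc k) = p * (\<mu> k - f (x (Suc k)))" for k
    using rule unfolding average_rule_def by (simp add: algebra_simps)
  have "\<mu> (Suc k) \<le> \<mu> k" for k
  proof -
    have "0 \<le> p * (\<mu> k - f (x (Suc k)))"
      using p desc[of k] by simp
    then show ?thesis using diff[of k] by linarith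
  qed
  then have dec: "decseq \<mu>" by (simp add: decseq_Suc_iff)
  obtain B where B: "\<And>l. B \<le> f (x (r l))"
    using convergent_imp_Bseq[OF convergentI[OF lim]] unfolding Bseq_def
    by (metis abs_le_D2 minus_le_iff real_norm_def)
  have "B \<le> \<mu> k" for k
  proof -
    have "B \<le> \<mu> (r k)" using B[of k] ref[of "r k"] by linarith
    also have "\<mu> (r k) \<le> \<mu> k"
      using dec r by (simp add: decseqD seq_suble)
    finally show ?thesis .
  qed
  then obtain m where m: "\<mu> \<longlonglongrightarrow> m"
    using decseq_convergent[OF dec, of B] by blast
  have "(\<lambda>k. (\<mu> k - \<mu> (Suc k)) / p) \<longlonglongrightarrow> (m - m) / p"
    by (intro tendsto_intros m LIMSEQ_Suc) (use p in auto)
  then show ?thesis using p by (simp add: diff)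
qed

text \<open>The reference values decrease to some \<open>m\<close>. Let \<open>q k\<close> be an index at which the maximum
  \<open>\<mu> k\<close> is attained. Then \<open>f (x (q k)) = \<mu> k\<close> and \<open>\<mu> (q k - 1)\<close> both tend to \<open>m\<close>; their gap
  dominates the squared length of the step leading to \<open>x (q k)\<close>, so this step vanishes, and by uniform continuity \<open>f (x (q k - 1))\<close> tends to \<open>m\<close> as well.
  Repeating this gives \<open>f (x (q k - i)) \<longlonglongrightarrow> m\<close> for each fixed \<open>i\<close>. Every index \<open>k\<close> has the form
  \<open>q (k + M) - i\<close> with \<open>i \<le> M\<close>, so finitely many of these limits cover the whole sequence.\<close>

lemma max_rule_vanishing_decrease:
  fixes x :: "nat \<Rightarrow> 'a::euclidean_space"
  assumes rule: "max_rule f M x \<mu>"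
    and desc: "\<And>k. (norm (x (Suc k) - x k))\<^sup>2 \<le> C * (\<mu> k - f (x (Suc k)))"
    and le: "\<And>k. f (x (Suc k)) \<le> \<mu> k"
    and S: "\<And>k. x k \<in> S" and bdd: "bdd_below (f ` S)" and uc: "uniformly_continuous_on S f"
  shows "(\<lambda>k. \<mu> k - f (x (Suc k))) \<longlonglongrightarrow> 0"
proof -
  have \<mu>: "\<mu> k = Max ((\<lambda>i. f (x i)) ` {k - M..k})" for k
    using rule unfolding max_rule_def by simp
  have ref: "f (x i) \<le> \<mu> k" if "k - M \<le> i" "i \<le> k" for i k
    unfolding \<mu> using that by (intro Max_ge) auto
  have "\<exists>i\<in>{k - M..k}. \<mu> k = f (x i)" for k
    using Max_in[of "(\<lambda>i. f (x i)) ` {k - M..k}"] unfolding \<mu>[symmetric] by auto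
  then obtain q where q: "\<And>k. k - M \<le> q k" "\<And>k. q k \<le> k" "\<And>k. \<mu> k = f (x (q k))"
    by (metis atLeastAtMost_iff)
  have "\<mu> (Suc k) \<le> \<mu> k" for k
  proof (cases "q (Suc k) = Suc k")
    case True
    then show ?thesis using q(3)[of "Suc k"] le[of k] by simp
  next
    case False
    then show ?thesis
      using q(1)[of "Suc k"] q(2)[of "Suc k"] ref[of k "q (Suc k)"] q(3)[of "Suc k"] by simp
  qed
  then have dec: "decseq \<mu>" by (simp add: decseq_Suc_iff)
  obtain B where "\<And>k. B \<le> f (x k)"
    using bdd S unfolding bdd_below_def by auto
  then have "\<And>k. B \<le> \<mu> k" using q(3) by simp
  then obtain m where m: "\<mu> \<longlonglongrightarrow> m"
    using decseq_convergent[OF dec, of B] by blast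
  have inf: "filterlim (\<lambda>k. q k - i) at_top sequentially" for i
    unfolding filterlim_at_top
  proof
    fix Z
    have "Z \<le> q k - i" if "Z + i + M \<le> k" for k
      using q(1)[of k] that by linarith
    then show "\<forall>\<^sub>F k in sequentially. Z \<le> q k - i"
      unfolding eventually_sequentially by blast
  qed
  have lagged: "(\<lambda>k. f (x (q k - i))) \<longlonglongrightarrow> m" for i
  proof (induction i)
    case 0
    show ?case using m by (simp add: q(3)[symmetric])
  next
    case (Suc i)
    let ?n = "\<lambda>k. q k - Suc i"
    \<comment> \<open>Truncated subtraction is harmless only when \<open>q k > i\<close>, which holds eventually.\<close>
    have pred: "\<forall>\<^sub>F k in sequentially. Suc (?n k) = q k - i"
      using eventually_compose_filterlim[OF eventually_ge_at_top[of 1] inf[of i]]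
      by eventually_elim auto
    have fn: "(\<lambda>k. f (x (Suc (?n k)))) \<longlonglongrightarrow> m"
      using pred by (intro Lim_transform_eventually[OF Suc]) (auto elim: eventually_mono)
    have "(\<lambda>k. \<mu> (?n k) - f (x (Suc (?n k)))) \<longlonglongrightarrow> m - m"
      by (intro tendsto_intros fn filterlim_compose[OF m inf])
    then have "(\<lambda>k. x (Suc (?n k)) - x (?n k)) \<longlonglongrightarrow> 0"
      by (intro tendsto_zero_if_norm_sq_bounded[rotated, OF _ desc]) simp
    then have "(\<lambda>k. dist (x (Suc (?n k))) (x (?n k))) \<longlonglongrightarrow> 0"
      by (simp add: dist_norm tendsto_norm_zero_iff)
    then have "(\<lambda>k. dist (f (x (Suc (?n k)))) (f (x (?n k)))) \<longlonglongrightarrow> 0"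
      by (intro uc[unfolded uniformly_continuous_on_sequentially, rule_format]) (simp_all add: S)
    then have "(\<lambda>k. f (x (Suc (?n k))) - f (x (?n k))) \<longlonglongrightarrow> 0"
      by (simp add: dist_norm tendsto_rabs_zero_iff)
    from tendsto_diff[OF fn this] show ?case by simp
  qed
  have "(\<lambda>k. f (x k) - m) \<longlonglongrightarrow> 0"
  proof (rule Lim_null_comparison)
    \<comment> \<open>The lag \<open>i\<close> varies with \<open>k\<close>; summing over all possible lags makes the bound uniform.\<close>
    have "(\<lambda>k. \<Sum>i\<le>M. \<bar>f (x (q (k + M) - i)) - m\<bar>) \<longlonglongrightarrow> (\<Sum>i\<le>M. \<bar>m - m\<bar>)"
      by (intro tendsto_intros LIMSEQ_ignore_initial_segment[OF lagged])
    then show "(\<lambda>k. \<Sum>i\<le>M. \<bar>f (x (q (k + M) - i)) - m\<bar>) \<longlonglongrightarrow> 0" by simp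
    have "\<bar>f (x k) - m\<bar> \<le> (\<Sum>i\<le>M. \<bar>f (x (q (k + M) - i)) - m\<bar>)" for k
    proof -
      let ?i = "q (k + M) - k"
      have i: "?i \<le> M" "q (k + M) - ?i = k"
        using q(1)[of "k + M"] q(2)[of "k + M"] by auto
      have "\<bar>f (x (q (k + M) - ?i)) - m\<bar> \<le> (\<Sum>i\<le>M. \<bar>f (x (q (k + M) - i)) - m\<bar>)"
        using i(1) by (intro member_le_sum) auto
      then show ?thesis using i(2) by simp
    qed
    then show "\<forall>\<^sub>F k in sequentially. norm (f (x k) - m)
        \<le> (\<Sum>i\<le>M. \<bar>f (x (q (k + M) - i)) - m\<bar>)" by simp
  qed
  then have "(\<lambda>k. f (x k)) \<longlonglongrightarrow> m" by (rule LIM_zero_cancel)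
  then have "(\<lambda>k. \<mu> k - f (x (Suc k))) \<longlonglongrightarrow> m - m"
    by (intro tendsto_intros m LIMSEQ_Suc)
  then show ?thesis by simp
qed

lemma max_rule_le_initial:
  assumes rule: "max_rule f M x \<mu>" and le: "\<And>k. f (x (Suc k)) \<le> \<mu> k"
  shows "f (x k) \<le> f (x 0)"
proof (induction k rule: less_induct)
  case (less k)
  show ?case
  proof (cases k)
    case (Suc n)
    have "\<mu> n \<le> f (x 0)"
      using rule less Suc unfolding max_rule_def by auto
    then show ?thesis using le[of n] Suc by simp
  qed simp
qed

section \<open>Accumulation points\<close>

theorem theorem4p5:
  fixes f :: "'a::euclidean_space \<Rightarrow> real"
    and grad :: "'a \<Rightarrow> 'a"
    and D :: "'a set"
    and \<tau> \<alpha>min \<alpha>max \<beta>max c \<delta> a :: real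
    and x :: "nat \<Rightarrow> 'a"
    and \<mu> :: "nat \<Rightarrow> real"
    and xbar :: 'a
  assumes "\<And>z. GDERIV f z :> grad z"
    and "continuous_on UNIV grad"
    and "D \<noteq> {}" and "closed D"
    and "0 \<le> \<tau>" and "\<tau> < \<alpha>min" and "\<alpha>min \<le> \<alpha>max"
    and "0 \<le> \<beta>max"
    and "0 < c" and "c < 1"
    and "0 < \<delta>" and "\<delta> < 1"
    and "2 \<le> a" and "\<tau> = 0"
    and "ggmm_sequence (M_stationary grad D) f grad D \<tau> \<alpha>min \<alpha>max \<beta>max c \<delta> a x \<mu>"
    and "((\<exists>M. max_rule f M x \<mu>) \<and>
            bdd_below (f ` {z \<in> D. f z \<le> f (x 0)}) \<and>
            uniformly_continuous_on {z \<in> D. f z \<le> f (x 0)} f)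
         \<or> (\<exists>p. 0 < p \<and> p \<le> 1 \<and> average_rule f p x \<mu>)"
    and "\<And>k. \<not> M_stationary grad D (x k)"
    and "accumulation_point x xbar"
  shows "M_stationary grad D xbar"
proof -
  note grad = assms(1) and par = \<open>0 < \<delta>\<close> \<open>\<delta> < 1\<close> \<open>0 < c\<close> \<open>c < 1\<close>
  have \<alpha>min: "0 < \<alpha>min" using assms(5,6) by simp
  define xprev where "xprev k = (if k = 0 then x 0 else x (k - 1))" for k
  define C where "C = \<beta>max / \<alpha>min"
  have x0: "x 0 \<in> D"
    and step: "\<And>k. ggmm_step f grad D 0 \<alpha>min \<alpha>max \<beta>max c \<delta> a (xprev k) (x k) (\<mu> k) (x (Suc k))"
    using assms(15,17) \<open>\<tau> = 0\<close> unfolding ggmm_sequence_def xprev_def by auto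
  have ref: "f (x k) \<le> \<mu> k" for k
    using step[of k] unfolding ggmm_step_def by blast
  have "\<exists>\<alpha> e e' y. 0 < \<alpha> \<and> \<alpha> \<le> \<alpha>max \<and> norm e \<le> C * norm (x k - xprev k) \<and>
      x (Suc k) \<in> proj_set D (x k - \<alpha> *\<^sub>R (grad (x k) - e)) \<and>
      sufficient_decrease f c \<alpha> (\<mu> k) (x k) (x (Suc k)) \<and>
      (\<alpha> < \<alpha>min \<longrightarrow> norm e' \<le> C * norm (x k - xprev k) \<and>
         y \<in> proj_set D (x k - (\<alpha> / \<delta>) *\<^sub>R (grad (x k) - e')) \<and>
         \<not> sufficient_decrease f c (\<alpha> / \<delta>) (\<mu> k) (x k) y)" for k
    using ggmm_step_as_perturbed_gradient_step[OF step[of k] par(1,2) _ \<alpha>min] \<open>2 \<le> a\<close>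
    unfolding C_def by (smt (verit))
  then obtain \<alpha> e e' y where
    \<alpha>: "\<And>k. 0 < \<alpha> k" "\<And>k. \<alpha> k \<le> \<alpha>max"
    and e: "\<And>k. norm (e k) \<le> C * norm (x k - xprev k)"
    and proj: "\<And>k. x (Suc k) \<in> proj_set D (x k - \<alpha> k *\<^sub>R (grad (x k) - e k))"
    and acc: "\<And>k. sufficient_decrease f c (\<alpha> k) (\<mu> k) (x k) (x (Suc k))"
    and e': "\<And>k. \<alpha> k < \<alpha>min \<Longrightarrow> norm (e' k) \<le> C * norm (x k - xprev k)"
    and proj': "\<And>k. \<alpha> k < \<alpha>min \<Longrightarrow>
      y k \<in> proj_set D (x k - (\<alpha> k / \<delta>) *\<^sub>R (grad (x k) - e' k))"
    and rej: "\<And>k. \<alpha> k < \<alpha>min \<Longrightarrow> \<not> sufficient_decrease f c (\<alpha> k / \<delta>) (\<mu> k) (x k) (y k)"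
    by metis
  have xD: "x k \<in> D" for k
    by (cases k) (use x0 proj proj_setD(1) in auto)
  have le: "f (x (Suc k)) \<le> \<mu> k" for k
    using sufficient_decrease_imp_le[OF acc \<alpha>(1) \<open>0 < c\<close>] .
  have desc: "(norm (x (Suc k) - x k))\<^sup>2 \<le> 2 * \<alpha>max / c * (\<mu> k - f (x (Suc k)))" for k
    using sufficient_decrease_step_bound[OF acc \<alpha> \<open>0 < c\<close>] .
  obtain r where r: "strict_mono r" and xr: "(\<lambda>l. x (r l)) \<longlonglongrightarrow> xbar"
    using assms(18) unfolding accumulation_point_def comp_def by auto
  have fcont: "isCont f z" for z
    using grad[of z] unfolding gderiv_def by (rule has_derivative_continuous)
  have gcont: "isCont grad z" for z
    using assms(2) by (simp add: continuous_on_eq_continuous_at)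

  have "(\<lambda>k. \<mu> k - f (x (Suc k))) \<longlonglongrightarrow> 0"
    using assms(16)
  proof (elim disjE conjE exE)
    fix p assume "0 < p" "average_rule f p x \<mu>"
    from average_rule_vanishing_decrease[where f = f and x = x, OF this(2,1) ref le r
        isCont_tendsto_compose[OF fcont xr]]
    show ?thesis .
  next
    fix M
    assume M: "max_rule f M x \<mu>"
    assume bdd: "bdd_below (f ` {z \<in> D. f z \<le> f (x 0)})"
      and uc: "uniformly_continuous_on {z \<in> D. f z \<le> f (x 0)} f"
    have "x k \<in> {z \<in> D. f z \<le> f (x 0)}" for k
      using max_rule_le_initial[where f = f and x = x, OF M le] xD by simp
    from max_rule_vanishing_decrease[where f = f and x = x, OF M desc le this bdd uc]
    show ?thesis .
  qed
  then have steps: "(\<lambda>k. x (Suc k) - x k) \<longlonglongrightarrow> 0"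
    by (rule tendsto_zero_if_norm_sq_bounded[rotated]) (rule desc)
  then have "(\<lambda>k. x (Suc k) - xprev (Suc k)) \<longlonglongrightarrow> 0"
    by (simp add: xprev_def)
  then have mom: "(\<lambda>k. x k - xprev k) \<longlonglongrightarrow> 0"
    by (rule LIMSEQ_imp_Suc)
  have pert: "(\<lambda>k. C * norm (x k - xprev k)) \<longlonglongrightarrow> 0"
    using tendsto_mult_right_zero[OF tendsto_norm_zero[OF mom]] .

  \<comment> \<open>The step sizes stay in a bounded interval, so a further subsequence makes them converge.\<close>
  have "bounded (range (\<lambda>l. \<alpha> (r l)))"
    using \<alpha> by (intro boundedI[of _ \<alpha>max]) (auto simp: less_imp_le)
  then obtain s \<alpha>lim where s: "strict_mono s" and \<alpha>lim: "(\<lambda>l. \<alpha> (r (s l))) \<longlonglongrightarrow> \<alpha>lim"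
    using bounded_imp_convergent_subsequence[of "\<lambda>l. \<alpha> (r l)"] unfolding comp_def by blast
  define q where "q = (\<lambda>l. r (s l))"
  have "strict_mono q"
    using strict_mono_o[OF r s] by (simp add: q_def comp_def)
  then have q: "filterlim q at_top sequentially"
    by (rule filterlim_subseq)
  have xq: "(\<lambda>l. x (q l)) \<longlonglongrightarrow> xbar"
    using LIMSEQ_subseq_LIMSEQ[OF xr s] by (simp add: q_def comp_def)
  have \<alpha>q: "(\<lambda>l. \<alpha> (q l)) \<longlonglongrightarrow> \<alpha>lim"
    using \<alpha>lim by (simp add: q_def)
  have gq: "(\<lambda>l. grad (x (q l))) \<longlonglongrightarrow> grad xbar"
    using isCont_tendsto_compose[OF gcont xq] .
  have pertq: "(\<lambda>l. C * norm (x (q l) - xprev (q l))) \<longlonglongrightarrow> 0"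
    using filterlim_compose[OF pert q] .
  have "- grad xbar \<in> normal_cone D xbar"
  proof (cases "\<alpha>lim = 0")
    case False
    \<comment> \<open>Step sizes bounded away from \<open>0\<close>: normals at the accepted points.\<close>
    have stepq: "(\<lambda>l. x (Suc (q l)) - x (q l)) \<longlonglongrightarrow> 0"
      using filterlim_compose[OF steps q] .
    have "(\<lambda>l. e (q l)) \<longlonglongrightarrow> 0"
      by (rule Lim_null_comparison[OF _ pertq]) (use e in simp)
    from tendsto_diff[OF gq this]
    have "(\<lambda>l. grad (x (q l)) - e (q l)) \<longlonglongrightarrow> grad xbar" by simp
    moreover have "(\<lambda>l. x (Suc (q l))) \<longlonglongrightarrow> xbar"
      using tendsto_add[OF stepq xq] by simp
    moreover have "(\<lambda>l. (x (q l) - x (Suc (q l))) /\<^sub>R \<alpha> (q l)) \<longlonglongrightarrow> 0"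
    proof -
      have "(\<lambda>l. inverse (\<alpha> (q l)) *\<^sub>R (- (x (Suc (q l)) - x (q l))))
          \<longlonglongrightarrow> inverse \<alpha>lim *\<^sub>R (- 0)"
        by (intro tendsto_intros \<alpha>q stepq False)
      then show ?thesis by simp
    qed
    ultimately show ?thesis
      by (intro normal_cone_proj_step_limit[where \<alpha> = "\<lambda>l. \<alpha> (q l)"]) (use \<alpha> proj in auto)
  next
    case True
    \<comment> \<open>Vanishing step sizes: normals at the last rejected trial points \<open>y (q l)\<close>.\<close>
    have small: "\<forall>\<^sub>F l in sequentially. \<alpha> (q l) < \<alpha>min"
      using order_tendstoD(2)[OF \<alpha>q[unfolded True] \<alpha>min] .
    have pos: "0 < \<alpha> k / \<delta>" for k
      using \<alpha>(1) par by simp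
    have "\<exists>\<xi>. \<alpha> k < \<alpha>min \<longrightarrow> \<xi> \<in> closed_segment (x k) (y k) \<and>
        norm ((x k - y k) /\<^sub>R (\<alpha> k / \<delta>))
          \<le> 2 / (1 - c) * (norm (e' k) + norm (grad \<xi> - grad (x k)))" for k
      using rejected_trial_residual[OF grad xD proj' rej ref pos \<open>c < 1\<close>] by metis
    then obtain \<xi> where \<xi>: "\<And>k. \<alpha> k < \<alpha>min \<Longrightarrow> \<xi> k \<in> closed_segment (x k) (y k)"
      and res: "\<And>k. \<alpha> k < \<alpha>min \<Longrightarrow> norm ((x k - y k) /\<^sub>R (\<alpha> k / \<delta>))
          \<le> 2 / (1 - c) * (norm (e' k) + norm (grad (\<xi> k) - grad (x k)))"
      by metis
    have e'q: "(\<lambda>l. e' (q l)) \<longlonglongrightarrow> 0"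
      by (rule Lim_null_comparison[OF _ pertq], use small in eventually_elim) (use e' in simp)
    have g'q: "(\<lambda>l. grad (x (q l)) - e' (q l)) \<longlonglongrightarrow> grad xbar"
      using tendsto_diff[OF gq e'q] by simp
    have ys: "(\<lambda>l. y (q l) - x (q l)) \<longlonglongrightarrow> 0"
    proof (rule Lim_null_comparison)
      have "(\<lambda>l. 2 * (\<alpha> (q l) / \<delta>) * norm (grad (x (q l)) - e' (q l)))
          \<longlonglongrightarrow> 2 * (0 / \<delta>) * norm (grad xbar)"
        by (intro tendsto_intros g'q \<alpha>q[unfolded True]) (use par in auto)
      then show "(\<lambda>l. 2 * (\<alpha> (q l) / \<delta>) * norm (grad (x (q l)) - e' (q l))) \<longlonglongrightarrow> 0"
        by simp
      show "\<forall>\<^sub>F l in sequentially. norm (y (q l) - x (q l))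
          \<le> 2 * (\<alpha> (q l) / \<delta>) * norm (grad (x (q l)) - e' (q l))"
        using small by eventually_elim (rule proj_step_norm_le[OF xD proj' pos])
    qed
    have yq: "(\<lambda>l. y (q l)) \<longlonglongrightarrow> xbar"
      using tendsto_add[OF ys xq] by simp
    have "(\<lambda>l. \<xi> (q l) - x (q l)) \<longlonglongrightarrow> 0"
      by (rule Lim_null_comparison[OF _ tendsto_norm_zero[OF ys]], use small in eventually_elim)
         (rule segment_bound1[OF \<xi>])
    from tendsto_add[OF this xq] have "(\<lambda>l. \<xi> (q l)) \<longlonglongrightarrow> xbar" by simp
    then have "(\<lambda>l. grad (\<xi> (q l))) \<longlonglongrightarrow> grad xbar"
      using isCont_tendsto_compose[OF gcont] by blast
    then have "(\<lambda>l. 2 / (1 - c) * (norm (e' (q l)) + norm (grad (\<xi> (q l)) - grad (x (q l)))))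
        \<longlonglongrightarrow> 2 / (1 - c) * (norm (0::'a) + norm (grad xbar - grad xbar))"
      by (intro tendsto_intros e'q gq)
    then have bnd: "(\<lambda>l. 2 / (1 - c) * (norm (e' (q l)) + norm (grad (\<xi> (q l)) - grad (x (q l)))))
        \<longlonglongrightarrow> 0" by simp
    have "(\<lambda>l. (x (q l) - y (q l)) /\<^sub>R (\<alpha> (q l) / \<delta>)) \<longlonglongrightarrow> 0"
      by (rule Lim_null_comparison[OF _ bnd], use small in eventually_elim) (rule res)
    moreover have "\<forall>\<^sub>F l in sequentially. 0 < \<alpha> (q l) / \<delta> \<and> y (q l) \<in>
        proj_set D (x (q l) - (\<alpha> (q l) / \<delta>) *\<^sub>R (grad (x (q l)) - e' (q l)))"
      using small by eventually_elim (use pos proj' in blast)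
    ultimately show ?thesis
      by (intro normal_cone_proj_step_limit[OF _ yq _ g'q])
  qed
  moreover have "xbar \<in> D"
    using closed_sequentially[OF \<open>closed D\<close> _ xr] xD by simp
  ultimately show ?thesis unfolding M_stationary_def by simp
qed

end
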